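(* Let $k>1$ be an integer. (1) For every prime $p$, $cw(Syl_p(S_{p^k}))=1$. (2) For every prime $p>2$, $cw(Syl_p(A_{p^k}))=1$.
   Context: $Syl_p(G)$ denotes a Sylow $p$-subgroup of the finite group $G$; $S_n$ and $A_n$ are the symmetric and alternating groups of degree $n$. Notation: $[a,b]=aba^{-1}b^{-1}$, and $G'=[G,G]$. The commutator length of $g\in G'$ is the minimal $n$ such that $g$ is a product of $n$ commutators of elements of $G$ (the identity has length $0$). The commutator width $cw(G)$ is the maximum of the commutator lengths of the elements of $G'$. *)

theory Defs
  imports "HOL-Algebra.Sym_Groups" "HOL-Algebra.Sylow"
begin

text \<open>\<open>P\<close> is the carrier of a Sylow \<open>p\<close>-subgroup of the finite group \<open>G\<close>.\<close>

definition sylow_subgroup :: "nat \<Rightarrow> 'a set \<Rightarrow> ('a, 'b) monoid_scheme \<Rightarrow> bool"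
  where "sylow_subgroup p P G \<longleftrightarrow> subgroup P G \<and> card P = p ^ multiplicity p (order G)"

definition commutator :: "('a, 'b) monoid_scheme \<Rightarrow> 'a \<Rightarrow> 'a \<Rightarrow> 'a"
  where "commutator G a b = a \<otimes>\<^bsub>G\<^esub> b \<otimes>\<^bsub>G\<^esub> inv\<^bsub>G\<^esub> a \<otimes>\<^bsub>G\<^esub> inv\<^bsub>G\<^esub> b"

definition product_of_commutators :: "('a, 'b) monoid_scheme \<Rightarrow> nat \<Rightarrow> 'a \<Rightarrow> bool"
  where "product_of_commutators G n g \<longleftrightarrow>
    (\<exists>cs. length cs = n \<and>
      set cs \<subseteq> {commutator G a b | a b. a \<in> carrier G \<and> b \<in> carrier G} \<and>
      g = foldr (mult G) cs \<one>\<^bsub>G\<^esub>)"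

text \<open>Meaningful only for elements of the derived subgroup \<open>derived G (carrier G)\<close>: there a
  representation exists, because the inverse of a commutator is a commutator. The empty product
  gives the identity length \<open>0\<close>.\<close>

definition commutator_length :: "('a, 'b) monoid_scheme \<Rightarrow> 'a \<Rightarrow> nat"
  where "commutator_length G g = (LEAST n. product_of_commutators G n g)"

text \<open>Intended for finite groups only, where the maximum is taken over a finite nonempty set.\<close>

definition commutator_width :: "('a, 'b) monoid_scheme \<Rightarrow> nat"
  where "commutator_width G = Max (commutator_length G ` derived G (carrier G))"

end

theory Submission
  imports Defs "HOL-Algebra.Group_Action" "HOL-Algebra.FiniteProduct" "HOL-Algebra.Elementary_Groups"
begin

text \<open>A Sylow \<open>p\<close>-subgroup of \<open>S\<close> on \<open>p ^ k\<close> points is an iterated wreath product of cyclic groups of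
  order \<open>p\<close>. By the conjugacy of Sylow subgroups and Legendre's formula it suffices to show that if
  every element of \<open>B'\<close> is a commutator, the same is true of \<open>B\<close> wreath \<open>C\<^sub>n\<close>. Mapping into the
  abelianization of \<open>B\<close> shows that an element of the derived subgroup of the wreath product lies in the
  base group and has coordinates \<open>h\<^sub>0, \<dots>, h\<^sub>n\<^sub>-\<^sub>1\<close> whose product lies in \<open>B'\<close>. If that
  product is a single commutator \<open>[v, u]\<close>, the recurrence that expresses \<open>h\<close> as a commutator of a
  base element with a shift can be solved coordinate by coordinate. For odd \<open>p\<close> the Sylow
  \<open>p\<close>-subgroups of the alternating group are those of the symmetric group.\<close>

section \<open>Commutator width one and its invariance under isomorphism\<close>

definition derived_commutators :: "('a, 'b) monoid_scheme \<Rightarrow> bool"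
  where "derived_commutators G \<longleftrightarrow>
    (\<forall>g \<in> derived G (carrier G). \<exists>a \<in> carrier G. \<exists>b \<in> carrier G. g = commutator G a b)"

lemma (in group) commutator_eq_one_iff:
  assumes "a \<in> carrier G" "b \<in> carrier G"
  shows "commutator G a b = \<one> \<longleftrightarrow> a \<otimes> b = b \<otimes> a"
proof -
  have "commutator G a b = (a \<otimes> b) \<otimes> inv (b \<otimes> a)"
    using assms by (simp add: commutator_def inv_mult_group m_assoc)
  then show ?thesis
    using assms by (metis inv_equality inv_inv m_closed inv_closed r_inv)
qed

lemma (in group) commutator_in_derived:
  assumes "a \<in> carrier G" "b \<in> carrier G"
  shows "commutator G a b \<in> derived G (carrier G)"
  unfolding derived_def commutator_def using assms by (intro generate.incl) auto

text \<open>Noncommutativity supplies the lower bound: some commutator differs from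
  \<open>\<one>\<close>, so its length is not 0. Finiteness makes the \<open>Max\<close>
  meaningful.\<close>

lemma (in group) commutator_width_eq_1:
  assumes fin: "finite (carrier G)" and dc: "derived_commutators G" and nc: "\<not> comm_group G"
  shows "commutator_width G = 1"
proof -
  have one: "product_of_commutators G 1 g" if g: "g \<in> derived G (carrier G)" for g
  proof -
    from dc g obtain a b where ab: "a \<in> carrier G" "b \<in> carrier G" "g = commutator G a b"
      unfolding derived_commutators_def by blast
    then have "g \<in> carrier G"
      using derived_in_carrier[of "carrier G"] g by blast
    with ab show ?thesis
      unfolding product_of_commutators_def by (intro exI[of _ "[g]"]) auto
  qed
  then have le: "commutator_length G g \<le> 1" if "g \<in> derived G (carrier G)" for g
    unfolding commutator_length_def using that by (intro Least_le)
  from nc obtain a b where ab: "a \<in> carrier G" "b \<in> carrier G" "a \<otimes> b \<noteq> b \<otimes> a"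
    using group_comm_groupI by blast
  let ?c = "commutator G a b"
  have c: "?c \<in> derived G (carrier G)" "?c \<noteq> \<one>"
    using ab commutator_in_derived commutator_eq_one_iff by auto
  have "product_of_commutators G (commutator_length G ?c) ?c"
    unfolding commutator_length_def by (rule LeastI[of _ 1]) (rule one[OF c(1)])
  moreover have "\<not> product_of_commutators G 0 ?c"
    using c(2) by (auto simp: product_of_commutators_def)
  ultimately have "commutator_length G ?c \<noteq> 0"
    by metis
  with le[OF c(1)] have len: "commutator_length G ?c = 1" by linarith
  have "finite (derived G (carrier G))"
    using fin derived_in_carrier[of "carrier G"] finite_subset by blast
  then show ?thesis
    unfolding commutator_width_def
    by (intro Max_eqI) (use le len c(1) in force)+
qed

lemma (in comm_group) derived_commutators: "derived_commutators G"
  using derived_eq_singleton[OF subset_refl] commutator_eq_one_iff[of \<one> \<one>]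
  by (force simp: derived_commutators_def intro: one_closed)

text \<open>An isomorphism maps derived subgroup onto derived subgroup and commutators to
  commutators. This carries the property from a wreath product to its permutation image, and from
  one Sylow subgroup to the others.\<close>

lemma derived_commutators_iso:
  assumes "group G" "group H" "h \<in> iso G H" "derived_commutators G"
  shows "derived_commutators H"
proof -
  interpret group_hom G H h
    using assms by (simp add: group_hom_def group_hom_axioms_def iso_def)
  have im: "h ` carrier G = carrier H"
    using assms(3) by (simp add: iso_def bij_betw_def)
  have comm: "h (commutator G a b) = commutator H (h a) (h b)"
    if "a \<in> carrier G" "b \<in> carrier G" for a b
    using that by (simp add: commutator_def)
  have "derived H (carrier H) = h ` derived G (carrier G)"
    using derived_img[of "carrier G"] im by simp
  then show ?thesis
    using assms(4) unfolding derived_commutators_def im[symmetric] by (fastforce simp: comm)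
qed

lemma comm_group_iso_iff:
  assumes "group G" "group H" "G \<cong> H"
  shows "comm_group G \<longleftrightarrow> comm_group H"
  using comm_group.iso_imp_comm_group[OF _ assms(3)] comm_group.iso_imp_comm_group[of H G]
    group.iso_sym[OF assms(1,3)] assms(1,2)[THEN group.is_monoid] by blast

section \<open>Conjugacy of Sylow subgroups\<close>

text \<open>Orbit lengths divide \<open>p ^ a\<close>, so each is a power of \<open>p\<close>. They
  sum to \<open>card E\<close>, so some orbit has length prime to \<open>p\<close>, and that length
  must be 1.\<close>

lemma p_group_fixed_point:
  assumes "group_action G E \<phi>" "finite E" "Factorial_Ring.prime p" "order G = p ^ a"
    and "\<not> p dvd card E"
  obtains x where "x \<in> E" "\<And>g. g \<in> carrier G \<Longrightarrow> \<phi> g x = x"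
proof -
  interpret group_action G E \<phi> by fact
  have "(\<Sum>orb\<in>orbits G E \<phi>. card orb) = card E"
    using disjoint_sum[OF assms(2), of "\<lambda>_. 1::nat"] by simp
  then obtain orb where orb: "orb \<in> orbits G E \<phi>" "\<not> p dvd card orb"
    using assms(5) by (metis dvd_sum)
  then obtain x where x: "x \<in> E" "orb = orbit G \<phi> x"
    unfolding orbits_def by blast
  have "card orb dvd p ^ a"
    using orbit_stabilizer_theorem[OF x(1)] assms(4) x(2) by (metis dvd_triv_left)
  then obtain i where i: "card orb = p ^ i"
    using divides_primepow_nat[OF assms(3)] by blast
  with orb(2) have "card orb = 1"
    by (cases i) auto
  then obtain y where "orb = {y}"
    using card_1_singletonE by blast
  then have "orbit G \<phi> x = {x}"
    using orbit_refl[OF x(1)] x(2) by auto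
  then have "\<phi> g x = x" if "g \<in> carrier G" for g
    using that unfolding orbit_def by blast
  with x(1) show ?thesis using that by blast
qed

text \<open>The inverse turns right multiplication into a left action. The restriction to
  \<open>rcosets H\<close> is there because the members of \<open>Bij\<close> are
  extensional.\<close>

lemma (in group) rcosets_action:
  assumes "subgroup H G"
  shows "group_action G (rcosets H) (\<lambda>g. \<lambda>R \<in> rcosets H. R #> inv g)"
proof -
  have sub: "H \<subseteq> carrier G"
    using assms subgroup.subset by blast
  have sR: "R \<subseteq> carrier G" if "R \<in> rcosets H" for R
    using that assms subgroup.rcosets_carrier is_group by blast
  have cl: "R #> g \<in> rcosets H" if "R \<in> rcosets H" "g \<in> carrier G" for R g
    using that sub unfolding RCOSETS_def by (auto simp: coset_mult_assoc)
  have bij: "(\<lambda>R \<in> rcosets H. R #> inv g) \<in> Bij (rcosets H)" if g: "g \<in> carrier G" for g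
    unfolding Bij_def
    using g sR by (auto simp: coset_mult_assoc cl intro!: bij_betw_byWitness[where f' = "\<lambda>R. R #> g"])
  have hom: "(\<lambda>R \<in> rcosets H. R #> inv (g \<otimes> g')) =
      compose (rcosets H) (\<lambda>R \<in> rcosets H. R #> inv g) (\<lambda>R \<in> rcosets H. R #> inv g')"
    if "g \<in> carrier G" "g' \<in> carrier G" for g g'
    using that by (auto simp: compose_def fun_eq_iff coset_mult_assoc sR cl inv_mult_group)
  show ?thesis
    unfolding group_action_def group_hom_def group_hom_axioms_def
  proof (intro conjI is_group group_BijGroup)
    show "(\<lambda>g. \<lambda>R \<in> rcosets H. R #> inv g) \<in> hom G (BijGroup (rcosets H))"
      using bij hom by (auto simp: hom_def BijGroup_def)
  qed
qed

text \<open>Let \<open>P\<close> act on the right cosets of \<open>H\<close>. Their number is prime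
  to \<open>p\<close>, so some coset \<open>H #> g\<close> is fixed, and
  \<open>H #> g #> x = H #> g\<close> says that the conjugate of \<open>x\<close> by
  \<open>g\<close> lies in \<open>H\<close>.\<close>

lemma (in group) p_subgroup_conjugate_into:
  assumes fin: "finite (carrier G)" and p: "Factorial_Ring.prime p"
    and H: "subgroup H G" "\<not> p dvd card (rcosets H)"
    and P: "subgroup P G" "card P = p ^ a"
  obtains g where "g \<in> carrier G" "\<And>x. x \<in> P \<Longrightarrow> g \<otimes> x \<otimes> inv g \<in> H"
proof -
  let ?E = "rcosets H" and ?\<phi> = "\<lambda>g. \<lambda>R \<in> rcosets H. R #> inv g"
  have E: "finite ?E"
    using fin H(1) by (simp add: RCOSETS_def)
  have act: "group_action (G\<lparr>carrier := P\<rparr>) ?E ?\<phi>"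
    using group_action.induced_action[OF rcosets_action[OF H(1)] P(1)] .
  have ord: "order (G\<lparr>carrier := P\<rparr>) = p ^ a"
    using P(2) by (simp add: order_def)
  obtain R where R: "R \<in> ?E" "\<And>x. x \<in> P \<Longrightarrow> ?\<phi> x R = R"
    by (rule p_group_fixed_point[OF act E p ord H(2)]) simp
  from R(1) obtain g where g: "g \<in> carrier G" "R = H #> g"
    unfolding RCOSETS_def by auto
  have "g \<otimes> x \<otimes> inv g \<in> H" if x: "x \<in> P" for x
  proof -
    have xc: "x \<in> carrier G" "inv x \<in> P"
      using x P(1) by (auto simp: subgroup.m_inv_closed subgroup.mem_carrier)
    \<comment> \<open>The action multiplies by inverses, so it is \<open>inv x\<close> that acts as
      right multiplication by \<open>x\<close>.\<close>
    have "H #> g #> x = H #> g"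
      using R(2)[OF xc(2)] R(1) g(2) xc by simp
    moreover have "H \<subseteq> carrier G"
      using H(1) subgroup.subset by blast
    ultimately have "H #> (g \<otimes> x \<otimes> inv g) = H"
      using g(1) xc(1) by (metis coset_mult_assoc coset_mult_inv1 coset_mult_one inv_closed m_closed r_inv)
    then show ?thesis
      using g(1) xc(1) H(1) by (metis coset_join1 inv_closed m_closed subgroup.subset)
  qed
  with g(1) show ?thesis using that by blast
qed

text \<open>The index of \<open>Q\<close> is prime to \<open>p\<close>, since \<open>card Q\<close>
  is the full power of \<open>p\<close> in the order. So a conjugation maps \<open>P\<close> into
  \<open>Q\<close>; it is injective, and equal cardinalities make it onto.\<close>

lemma (in group) sylow_subgroups_iso:
  assumes fin: "finite (carrier G)" and p: "Factorial_Ring.prime p"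
    and "sylow_subgroup p P G" "sylow_subgroup p Q G"
  shows "G\<lparr>carrier := P\<rparr> \<cong> G\<lparr>carrier := Q\<rparr>"
proof -
  have P: "subgroup P G" "card P = p ^ multiplicity p (order G)"
    and Q: "subgroup Q G" "card Q = p ^ multiplicity p (order G)"
    using assms by (auto simp: sylow_subgroup_def)
  have ord: "order G > 0"
    using fin order_gt_0_iff_finite by blast
  have "\<not> p dvd card (rcosets Q)"
  proof
    assume "p dvd card (rcosets Q)"
    then have "p * card Q dvd order G"
      using lagrange[OF Q(1)] by (metis dvd_refl mult_dvd_mono)
    then have "p ^ Suc (multiplicity p (order G)) dvd order G"
      using Q(2) by simp
    then show False
      using p ord by (metis neq0_conv not_prime_unit
          power_dvd_iff_le_multiplicity Suc_n_not_le_n)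
  qed
  then obtain g where g: "g \<in> carrier G" "\<And>x. x \<in> P \<Longrightarrow> g \<otimes> x \<otimes> inv g \<in> Q"
    using p_subgroup_conjugate_into[OF fin p Q(1) _ P] by blast
  let ?h = "\<lambda>x. g \<otimes> x \<otimes> inv g"
  have sub: "x \<in> carrier G" if "x \<in> P" for x
    using that P(1) subgroup.mem_carrier by fastforce
  have inj: "inj_on ?h P"
    using g(1) sub by (auto intro!: inj_onI)
  have "finite Q"
    using Q(1) fin finite_subset subgroup.subset by metis
  then have "?h ` P = Q"
    using card_image[OF inj] P(2) Q(2) g(2) by (intro card_subset_eq) auto
  moreover have "?h \<in> hom (G\<lparr>carrier := P\<rparr>) (G\<lparr>carrier := Q\<rparr>)"
  proof (rule homI)
    show "?h x \<in> carrier (G\<lparr>carrier := Q\<rparr>)" if "x \<in> carrier (G\<lparr>carrier := P\<rparr>)" for x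
      using that g(2) by simp
    show "?h (x \<otimes>\<^bsub>G\<lparr>carrier := P\<rparr>\<^esub> y) = ?h x \<otimes>\<^bsub>G\<lparr>carrier := Q\<rparr>\<^esub> ?h y"
      if "x \<in> carrier (G\<lparr>carrier := P\<rparr>)" "y \<in> carrier (G\<lparr>carrier := P\<rparr>)" for x y
      using that sub g(1) by (simp add: m_assoc inv_solve_left)
  qed
  ultimately show ?thesis
    using inj by (auto simp: is_iso_def iso_def bij_betw_def)
qed

section \<open>Wreath products with a cyclic group\<close>

text \<open>The top group is cyclic of order \<open>n\<close>, written as the residues below \<open>n\<close>. The order of the factors
  is chosen so that \<open>(f, i)\<close> acts on blocks from the left by \<open>(y, r) \<mapsto> (y + i, f y r)\<close>.\<close>

definition wreath :: "('a, 'b) monoid_scheme \<Rightarrow> nat \<Rightarrow> ((nat \<Rightarrow> 'a) \<times> nat) monoid"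
  where "wreath G n =
    \<lparr>carrier = ({..<n} \<rightarrow>\<^sub>E carrier G) \<times> {..<n},
     mult = (\<lambda>(f, i) (g, j). (\<lambda>x\<in>{..<n}. f ((x + j) mod n) \<otimes>\<^bsub>G\<^esub> g x, (i + j) mod n)),
     one = (\<lambda>x\<in>{..<n}. \<one>\<^bsub>G\<^esub>, 0)\<rparr>"

lemma carrier_wreath: "carrier (wreath G n) = ({..<n} \<rightarrow>\<^sub>E carrier G) \<times> {..<n}"
  by (simp add: wreath_def)

lemma mult_wreath: "(f, i) \<otimes>\<^bsub>wreath G n\<^esub> (g, j) =
    (\<lambda>x\<in>{..<n}. f ((x + j) mod n) \<otimes>\<^bsub>G\<^esub> g x, (i + j) mod n)"
  by (simp add: wreath_def)

lemma one_wreath: "\<one>\<^bsub>wreath G n\<^esub> = (\<lambda>x\<in>{..<n}. \<one>\<^bsub>G\<^esub>, 0)"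
  by (simp add: wreath_def)

lemma card_wreath: "card (carrier (wreath G n)) = card (carrier G) ^ n * n"
  by (simp add: carrier_wreath card_cartesian_product card_PiE)

lemma mod_shift_inverse:
  fixes n :: nat
  assumes "n dvd j + k" "x < n"
  shows "((x + j) mod n + k) mod n = x"
proof -
  obtain q where q: "j + k = n * q"
    using assms(1) by blast
  have "((x + j) mod n + k) mod n = (x + (j + k)) mod n"
    by (simp add: mod_simps add.assoc)
  then show ?thesis
    using assms(2) by (simp add: q)
qed

lemma bij_betw_shift_mod: "bij_betw (\<lambda>x. (x + j) mod n) {..<n} {..<n}" for n :: nat
proof (cases "n = 0")
  case False
  \<comment> \<open>Since \<open>j\<close> may exceed \<open>n\<close>, the inverse shift is by
    \<open>n - j mod n\<close>; then \<open>j + k\<close> is the multiple \<open>n * (q + 1)\<close>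
    of \<open>n\<close>.\<close>
  define q r k where "q = j div n" and "r = j mod n" and "k = n - r"
  then have "j = n * q + r" "r < n"
    using False by simp_all
  then have "j + k = n * (q + 1)" "k + j = n * (q + 1)"
    by (simp_all add: k_def)
  then have "n dvd j + k" "n dvd k + j"
    by (metis dvd_triv_left)+
  then show ?thesis
    using False mod_shift_inverse[of n]
    by (intro bij_betw_byWitness[where f' = "\<lambda>x. (x + k) mod n"]) auto
qed (simp add: bij_betw_def)

lemma (in group) wreath_group:
  assumes "n > 0"
  shows "group (wreath G n)"
proof (rule groupI)
  fix a b c assume "a \<in> carrier (wreath G n)" "b \<in> carrier (wreath G n)" "c \<in> carrier (wreath G n)"
  then obtain f i g j h k where
    abc: "a = (f, i)" "b = (g, j)" "c = (h, k)"
    and f: "f \<in> {..<n} \<rightarrow>\<^sub>E carrier G" and g: "g \<in> {..<n} \<rightarrow>\<^sub>E carrier G" and h: "h \<in> {..<n} \<rightarrow>\<^sub>E carrier G"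
    by (auto simp: carrier_wreath)
  have m: "x mod n \<in> {..<n}" for x
    using assms by simp
  note mem = PiE_mem[OF f m] PiE_mem[OF g m] PiE_mem[OF h m] PiE_mem[OF f] PiE_mem[OF g] PiE_mem[OF h]
  show "a \<otimes>\<^bsub>wreath G n\<^esub> b \<in> carrier (wreath G n)"
    unfolding abc mult_wreath using mem assms by (auto simp: carrier_wreath)
  show "a \<otimes>\<^bsub>wreath G n\<^esub> b \<otimes>\<^bsub>wreath G n\<^esub> c = a \<otimes>\<^bsub>wreath G n\<^esub> (b \<otimes>\<^bsub>wreath G n\<^esub> c)"
    unfolding abc mult_wreath using mem m
    by (auto simp: fun_eq_iff m_assoc mod_simps ac_simps)
next
  show "\<one>\<^bsub>wreath G n\<^esub> \<in> carrier (wreath G n)"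
    using assms by (auto simp: carrier_wreath one_wreath)
next
  fix a assume "a \<in> carrier (wreath G n)"
  then obtain f i where a: "a = (f, i)" and f: "f \<in> {..<n} \<rightarrow>\<^sub>E carrier G" and i: "i < n"
    by (auto simp: carrier_wreath)
  have m: "x mod n \<in> {..<n}" for x
    using assms by simp
  show "\<one>\<^bsub>wreath G n\<^esub> \<otimes>\<^bsub>wreath G n\<^esub> a = a"
    unfolding a one_wreath mult_wreath using f i m by (auto simp: fun_eq_iff PiE_mem[OF f] PiE_arb[OF f])
  \<comment> \<open>\<open>k\<close> is the residue of \<open>- i\<close>; the outer
    \<open>mod n\<close> covers \<open>i = 0\<close>, where \<open>n - i\<close> is out of range.
    Multiplying on the right by \<open>a\<close> evaluates the left factor at \<open>x + i\<close>,
    so shifting back by \<open>k\<close> makes \<open>f\<close> cancel at \<open>x\<close>.\<close>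
  define k where "k = (n - i) mod n"
  have k: "k < n" "(k + i) mod n = 0" "n dvd i + k"
    using i by (auto simp: k_def mod_simps dvd_eq_mod_eq_0)
  let ?b = "(\<lambda>x\<in>{..<n}. inv (f ((x + k) mod n)), k)"
  have "inv (f (((x + i) mod n + k) mod n)) \<otimes> f x = \<one>" if "x < n" for x
    unfolding mod_shift_inverse[OF k(3) that] using that PiE_mem[OF f] by simp
  then have "?b \<otimes>\<^bsub>wreath G n\<^esub> a = \<one>\<^bsub>wreath G n\<^esub>"
    unfolding a one_wreath mult_wreath using k(2) m by (auto simp: fun_eq_iff)
  moreover have "?b \<in> carrier (wreath G n)"
    using m k(1) PiE_mem[OF f m] by (auto simp: carrier_wreath)
  ultimately show "\<exists>b\<in>carrier (wreath G n). b \<otimes>\<^bsub>wreath G n\<^esub> a = \<one>\<^bsub>wreath G n\<^esub>"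
    by blast
qed

section \<open>The derived subgroup of the wreath product\<close>

lemma (in group) hom_comm_group_derived:
  assumes "comm_group H" "h \<in> hom G H" "g \<in> derived G (carrier G)"
  shows "h g = \<one>\<^bsub>H\<^esub>"
proof -
  interpret H: comm_group H by fact
  interpret group_hom G H h
    using assms(2) by unfold_locales
  have "h ` carrier G \<subseteq> carrier H"
    by auto
  then have "h ` derived G (carrier G) = {\<one>\<^bsub>H\<^esub>}"
    using derived_img[of "carrier G"] H.derived_eq_singleton[of "h ` carrier G"] by simp
  with assms(3) show ?thesis by blast
qed

text \<open>The factors run from index \<open>z\<close> down to 0, both included. This is the order
  in which the recurrence \<open>b (Suc z) = h (Suc z) \<otimes> b z\<close> unrolls.\<close>

primrec rev_prod :: "('a, 'b) monoid_scheme \<Rightarrow> (nat \<Rightarrow> 'a) \<Rightarrow> nat \<Rightarrow> 'a"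
  where "rev_prod G h 0 = h 0"
  | "rev_prod G h (Suc z) = h (Suc z) \<otimes>\<^bsub>G\<^esub> rev_prod G h z"

lemma (in monoid) rev_prod_closed:
  assumes "\<And>x. x \<le> z \<Longrightarrow> h x \<in> carrier G"
  shows "rev_prod G h z \<in> carrier G"
  using assms by (induction z) auto

lemma hom_rev_prod:
  assumes "group G" "comm_group H" "\<phi> \<in> hom G H" "\<And>x. x \<le> z \<Longrightarrow> h x \<in> carrier G"
  shows "\<phi> (rev_prod G h z) = finprod H (\<lambda>x. \<phi> (h x)) {..z}"
  using assms(4)
proof (induction z)
  interpret G: group G by fact
  interpret H: comm_group H by fact
  {
    case 0
    then show ?case
      using hom_in_carrier[OF assms(3), of "h 0"] H.finprod_0[of "\<lambda>x. \<phi> (h x)"] by auto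
  next
    case (Suc z)
    then have "\<phi> (rev_prod G h (Suc z)) = \<phi> (h (Suc z)) \<otimes>\<^bsub>H\<^esub> \<phi> (rev_prod G h z)"
      using assms(3) by (simp add: hom_mult G.rev_prod_closed)
    also have "\<dots> = finprod H (\<lambda>x. \<phi> (h x)) {..Suc z}"
      using Suc assms(3) by (simp add: atMost_Suc hom_in_carrier Pi_iff)
    finally show ?case .
  }
qed

text \<open>The shift in the wreath multiplication only permutes the coordinates of the left factor,
  which a product in the commutative group \<open>H\<close> does not see.\<close>

lemma wreath_finprod_hom:
  assumes "group G" "comm_group H" and q: "q \<in> hom G H" and n: "n > 0"
  shows "(\<lambda>(f, i). finprod H (\<lambda>x. q (f x)) {..<n}) \<in> hom (wreath G n) H"
proof -
  interpret G: group G by fact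
  interpret H: comm_group H by fact
  show ?thesis
  proof (rule homI, safe)
    fix f i assume "(f, i) \<in> carrier (wreath G n)"
    then have f: "f \<in> {..<n} \<rightarrow> carrier G"
      by (auto simp: carrier_wreath)
    show "finprod H (\<lambda>x. q (f x)) {..<n} \<in> carrier H"
      using funcset_mem[OF f] hom_in_carrier[OF q] by (intro H.finprod_closed) auto
  next
    fix f i g j assume "(f, i) \<in> carrier (wreath G n)" "(g, j) \<in> carrier (wreath G n)"
    then have fg: "f \<in> {..<n} \<rightarrow> carrier G" "g \<in> {..<n} \<rightarrow> carrier G"
      by (auto simp: carrier_wreath)
    let ?s = "\<lambda>x. (x + j) mod n"
    have m: "?s x \<in> {..<n}" for x
      using n by simp
    have qf: "(\<lambda>x. q (f x)) \<in> {..<n} \<rightarrow> carrier H" and qg: "(\<lambda>x. q (g x)) \<in> {..<n} \<rightarrow> carrier H"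
      using funcset_mem[OF fg(1)] funcset_mem[OF fg(2)] hom_in_carrier[OF q] by auto
    have "finprod H (\<lambda>x. q ((\<lambda>x\<in>{..<n}. f (?s x) \<otimes>\<^bsub>G\<^esub> g x) x)) {..<n} =
        finprod H (\<lambda>x. q (f (?s x)) \<otimes>\<^bsub>H\<^esub> q (g x)) {..<n}"
      using funcset_mem[OF fg(1) m] funcset_mem[OF fg(2)] funcset_mem[OF qf m] funcset_mem[OF qg]
      by (intro H.finprod_cong') (auto simp: hom_mult[OF q])
    also have "\<dots> = finprod H (\<lambda>x. q (f (?s x))) {..<n} \<otimes>\<^bsub>H\<^esub> finprod H (\<lambda>x. q (g x)) {..<n}"
      using qg funcset_mem[OF qf m] by (intro H.finprod_multf) auto
    also have "finprod H (\<lambda>x. q (f (?s x))) {..<n} = finprod H (\<lambda>x. q (f x)) {..<n}"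
      using H.finprod_reindex[of "\<lambda>x. q (f x)" ?s "{..<n}"] bij_betw_shift_mod[of j n] qf
      by (simp add: bij_betw_def)
    finally show "(case (f, i) \<otimes>\<^bsub>wreath G n\<^esub> (g, j) of (f, i) \<Rightarrow> finprod H (\<lambda>x. q (f x)) {..<n}) =
        finprod H (\<lambda>x. q (f x)) {..<n} \<otimes>\<^bsub>H\<^esub> finprod H (\<lambda>x. q (g x)) {..<n}"
      unfolding mult_wreath by simp
  qed
qed

text \<open>Two homomorphisms into commutative groups are tested. Projection to the residues modulo
  \<open>n\<close> forces the second component to be 0. The product of the coordinates in the
  abelianization places \<open>rev_prod\<close> in the derived subgroup; there the order of the
  factors is immaterial.\<close>

lemma (in group) wreath_derived:
  assumes n: "n > 0" and w: "w \<in> derived (wreath G n) (carrier (wreath G n))"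
  obtains h where "w = (h, 0)" "h \<in> {..<n} \<rightarrow>\<^sub>E carrier G" "rev_prod G h (n - 1) \<in> derived G (carrier G)"
proof -
  interpret W: group "wreath G n"
    using n by (rule wreath_group)
  let ?D = "derived G (carrier G)"
  have norm: "?D \<lhd> G"
    using derived_is_normal normal_self by blast
  interpret Q: comm_group "G Mod ?D"
    by (rule derived_quot_is_comm_group)
  have q: "(\<lambda>a. ?D #> a) \<in> hom G (G Mod ?D)"
    using norm by (rule normal.r_coset_hom_Mod)
  have "w \<in> carrier (wreath G n)"
    using W.derived_in_carrier[of "carrier (wreath G n)"] w by blast
  then obtain h i where hi: "w = (h, i)" "h \<in> {..<n} \<rightarrow>\<^sub>E carrier G" "i < n"
    by (auto simp: carrier_wreath)
  have "(\<lambda>(f, i). int i) \<in> hom (wreath G n) (integer_mod_group n)"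
  proof (rule homI, safe)
    show "int i \<in> carrier (integer_mod_group n)" if "(f, i) \<in> carrier (wreath G n)" for f i
      using n that by (simp add: carrier_wreath carrier_integer_mod_group)
    show "(case (f, i) \<otimes>\<^bsub>wreath G n\<^esub> (g, j) of (f, i) \<Rightarrow> int i) = int i \<otimes>\<^bsub>integer_mod_group n\<^esub> int j"
      for f i g j
      by (simp add: mult_wreath zmod_int)
  qed
  from W.hom_comm_group_derived[OF abelian_integer_mod_group this w] have "i = 0"
    by (simp add: hi(1))
  from W.hom_comm_group_derived[OF Q.comm_group_axioms wreath_finprod_hom[OF is_group Q.comm_group_axioms q n] w]
  have fp: "finprod (G Mod ?D) (\<lambda>x. ?D #> h x) {..<n} = ?D"
    by (simp add: hi(1) FactGroup_def)
  have hc: "h x \<in> carrier G" if "x \<le> n - 1" for x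
    using PiE_mem[OF hi(2)] n that by simp
  have "{..<n} = {..n - 1}"
    using n by auto
  then have "?D #> rev_prod G h (n - 1) = ?D"
    using fp hom_rev_prod[OF is_group Q.comm_group_axioms q hc] by simp
  then have "rev_prod G h (n - 1) \<in> ?D"
    using coset_join1[OF _ rev_prod_closed[OF hc] derived_is_subgroup[OF subset_refl]] by simp
  with hi \<open>i = 0\<close> show ?thesis using that by blast
qed

lemma (in group) derived_commutators_wreath:
  assumes n: "n > 1" and dc: "derived_commutators G"
  shows "derived_commutators (wreath G n)"
  unfolding derived_commutators_def
proof
  have n0: "n > 0" using n by simp
  interpret W: group "wreath G n"
    using n0 by (rule wreath_group)
  fix w assume "w \<in> derived (wreath G n) (carrier (wreath G n))"
  then obtain h where h: "w = (h, 0)" "h \<in> {..<n} \<rightarrow>\<^sub>E carrier G"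
    "rev_prod G h (n - 1) \<in> derived G (carrier G)"
    using wreath_derived[OF n0] by metis
  then obtain v u where vu: "v \<in> carrier G" "u \<in> carrier G" "rev_prod G h (n - 1) = commutator G v u"
    using dc unfolding derived_commutators_def by blast
  have hc: "h x \<in> carrier G" if "x < n" for x
    using PiE_mem[OF h(2)] that by simp
  have H: "rev_prod G h z \<in> carrier G" if "z < n" for z
    using that hc by (intro rev_prod_closed) simp
  txt \<open>\<open>h z = b z \<otimes> inv (b (z - 1))\<close> for \<open>z > 0\<close> forces the shape of \<open>b\<close>. The coordinate \<open>0\<close>, where the shift
    wraps around, then amounts to \<open>rev_prod G h (n - 1) = [v, u]\<close>.\<close>
  let ?b = "\<lambda>z\<in>{..<n}. rev_prod G h z \<otimes> u"
  let ?a = "\<lambda>z\<in>{..<n}. if z = n - 1 then inv v else \<one>"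
  have ab: "(?b, 0) \<in> carrier (wreath G n)" "(?a, 1) \<in> carrier (wreath G n)"
    using n H vu by (auto simp: carrier_wreath)
  \<comment> \<open>This is the coordinate form of \<open>w a b = b a\<close>, that is, of
    \<open>w = [b, a]\<close>: the second component 1 of the shift moves the index of every factor
    to its left.\<close>
  have "h (Suc z mod n) \<otimes> (?a z \<otimes> ?b z) = ?b (Suc z mod n) \<otimes> ?a z" if z: "z < n" for z
  proof (cases "z = n - 1")
    case True
    then have "Suc z mod n = 0"
      using n by simp
    moreover have "inv v \<otimes> (commutator G v u \<otimes> u) = u \<otimes> inv v"
      using vu m_assoc[of "inv v" v "u \<otimes> inv v"] by (simp add: commutator_def m_assoc)
    ultimately show ?thesis
      using True n vu(1,2) hc[of 0] by (simp add: vu(3)[unfolded One_nat_def] m_assoc)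
  next
    case False
    then have "Suc z < n"
      using z by linarith
    then show ?thesis
      using False z H[OF z] hc[OF \<open>Suc z < n\<close>] vu(1,2) by (simp add: m_assoc)
  qed
  then have eq: "(h, 0) \<otimes>\<^bsub>wreath G n\<^esub> ((?a, 1) \<otimes>\<^bsub>wreath G n\<^esub> (?b, 0)) = (?b, 0) \<otimes>\<^bsub>wreath G n\<^esub> (?a, 1)"
    unfolding mult_wreath using n by (auto simp: fun_eq_iff)
  have hw: "(h, 0) \<in> carrier (wreath G n)"
    using h(2) n by (simp add: carrier_wreath)
  have "w = commutator (wreath G n) (?b, 0) (?a, 1)"
    unfolding h(1) commutator_def
    using ab hw W.inv_solve_right[THEN iffD2, OF _ _ _ eq[symmetric]]
    by (simp add: W.inv_mult_group W.m_assoc)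
  with ab show "\<exists>a\<in>carrier (wreath G n). \<exists>b\<in>carrier (wreath G n). w = commutator (wreath G n) a b"
    by blast
qed

text \<open>The pure shift moves an element supported at coordinate 0: the two products have
  \<open>g\<close> and \<open>\<one>\<close> there.\<close>

lemma (in group) wreath_not_comm:
  assumes n: "n > 1" and g: "g \<in> carrier G" "g \<noteq> \<one>"
  shows "\<not> comm_group (wreath G n)"
proof
  assume "comm_group (wreath G n)"
  then interpret W: comm_group "wreath G n" .
  let ?x = "(\<lambda>z\<in>{..<n}. \<one>, 1)" and ?y = "(\<lambda>z\<in>{..<n}. if z = 0 then g else \<one>, 0)"
  have "?x \<in> carrier (wreath G n)" "?y \<in> carrier (wreath G n)"
    using n g by (auto simp: carrier_wreath)
  then have "?x \<otimes>\<^bsub>wreath G n\<^esub> ?y = ?y \<otimes>\<^bsub>wreath G n\<^esub> ?x"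
    by (rule W.m_comm)
  then have "fst (?x \<otimes>\<^bsub>wreath G n\<^esub> ?y) 0 = fst (?y \<otimes>\<^bsub>wreath G n\<^esub> ?x) 0"
    by simp
  with n g show False
    unfolding mult_wreath by simp
qed

section \<open>The wreath product as a group of permutations\<close>

text \<open>The point \<open>y * m + r\<close> with \<open>y < n\<close> and \<open>1 \<le> r \<le> m\<close> is the \<open>r\<close>-th point of block \<open>y\<close>.\<close>

definition wreath_perm :: "nat \<Rightarrow> nat \<Rightarrow> (nat \<Rightarrow> nat \<Rightarrow> nat) \<times> nat \<Rightarrow> nat \<Rightarrow> nat"
  where "wreath_perm m n = (\<lambda>(f, i) z.
    if z \<in> {1..m * n} then ((z - 1) div m + i) mod n * m + f ((z - 1) div m) ((z - 1) mod m + 1) else z)"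

lemma block_bound:
  fixes y r m n :: nat
  assumes "y < n" "r \<in> {1..m}"
  shows "y * m + r \<in> {1..m * n}"
proof -
  have "y * m + r \<le> Suc y * m"
    using assms(2) by simp
  also have "\<dots> \<le> n * m"
    using assms(1) by (intro mult_le_mono1) simp
  finally show ?thesis
    using assms(2) by (simp add: mult.commute)
qed

lemma block_div_mod:
  fixes y r m :: nat
  assumes "r \<in> {1..m}"
  shows "(y * m + r - 1) div m = y" "(y * m + r - 1) mod m + 1 = r"
proof -
  from assms obtain s where "r = Suc s" "s < m"
    by (metis Suc_le_eq atLeastAtMost_iff not0_implies_Suc not_one_le_zero)
  then show "(y * m + r - 1) div m = y" "(y * m + r - 1) mod m + 1 = r"
    by simp_all
qed

lemma block_decompose:
  fixes z m n :: nat
  assumes "z \<in> {1..m * n}"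
  obtains y r where "z = y * m + r" "y < n" "r \<in> {1..m}"
proof
  have "m > 0"
    using assms by (cases m) auto
  then show "(z - 1) mod m + 1 \<in> {1..m}"
    by (simp add: Suc_leI)
  show "z = (z - 1) div m * m + ((z - 1) mod m + 1)"
    using assms by simp
  show "(z - 1) div m < n"
    using assms by (intro less_mult_imp_div_less) (auto simp: mult.commute)
qed

lemma wreath_perm_block:
  assumes "y < n" "r \<in> {1..m}"
  shows "wreath_perm m n (f, i) (y * m + r) = (y + i) mod n * m + f y r"
  unfolding wreath_perm_def
  using block_bound[OF assms] block_div_mod[OF assms(2)] by simp

lemma wreath_perm_outside: "z \<notin> {1..m * n} \<Longrightarrow> wreath_perm m n w z = z"
  by (cases w) (auto simp: wreath_perm_def)

locale perm_subgroup =
  fixes m :: nat and Q :: "(nat \<Rightarrow> nat) set"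
  assumes subgroup: "subgroup Q (sym_group m)"
begin

abbreviation "B \<equiv> sym_group m\<lparr>carrier := Q\<rparr>"

lemma group_B: "group B"
  using group.subgroup_imp_group[OF sym_group_is_group subgroup] .

lemma permutes: "q \<in> Q \<Longrightarrow> q permutes {1..m}"
  using subgroup.mem_carrier[OF subgroup] by (simp add: sym_group_carrier)

text \<open>In a composition \<open>w\<close> acts first and moves block \<open>y\<close> to block
  \<open>y + j\<close>. The coordinate of \<open>v\<close> met next is therefore
  \<open>f ((y + j) mod n)\<close>, as in the wreath multiplication.\<close>

lemma wreath_perm_mult:
  assumes "v \<in> carrier (wreath B n)" "w \<in> carrier (wreath B n)"
  shows "wreath_perm m n (v \<otimes>\<^bsub>wreath B n\<^esub> w) = wreath_perm m n v \<circ> wreath_perm m n w"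
proof
  fix z
  obtain f i g j where vw: "v = (f, i)" "w = (g, j)"
    and fg: "f \<in> {..<n} \<rightarrow> Q" "g \<in> {..<n} \<rightarrow> Q"
    using assms by (cases v; cases w) (auto simp: carrier_wreath)
  show "wreath_perm m n (v \<otimes>\<^bsub>wreath B n\<^esub> w) z = (wreath_perm m n v \<circ> wreath_perm m n w) z"
  proof (cases "z \<in> {1..m * n}")
    case True
    then obtain y r where yr: "z = y * m + r" "y < n" "r \<in> {1..m}"
      by (rule block_decompose)
    have "g y \<in> Q"
      using funcset_mem[OF fg(2)] yr(2) by simp
    then have gr: "g y r \<in> {1..m}"
      using permutes_in_image[OF permutes] yr(3) by blast
    have "(y + j) mod n < n" "((y + j) mod n + i) mod n = (y + (i + j) mod n) mod n"
      using yr(2) by (simp_all add: mod_simps ac_simps)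
    then show ?thesis
      using yr(2) unfolding vw mult_wreath yr(1) comp_apply wreath_perm_block[OF yr(2,3)]
      by (simp add: wreath_perm_block[OF _ gr] sym_group_mult)
  qed (simp add: wreath_perm_outside)
qed

lemma wreath_perm_one: "wreath_perm m n \<one>\<^bsub>wreath B n\<^esub> = id"
proof
  fix z
  show "wreath_perm m n \<one>\<^bsub>wreath B n\<^esub> z = id z"
  proof (cases "z \<in> {1..m * n}")
    case True
    then obtain y r where "z = y * m + r" "y < n" "r \<in> {1..m}"
      by (rule block_decompose)
    then show ?thesis
      by (simp add: one_wreath wreath_perm_block sym_group_one)
  qed (simp add: wreath_perm_outside)
qed

text \<open>Bijectivity comes from the group structure: the inverse in the wreath product yields a
  two-sided inverse map.\<close>

lemma wreath_perm_permutes: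
  assumes "n > 0" "w \<in> carrier (wreath B n)"
  shows "wreath_perm m n w permutes {1..m * n}"
proof -
  interpret W: group "wreath B n"
    using group.wreath_group[OF group_B assms(1)] .
  have "wreath_perm m n (inv\<^bsub>wreath B n\<^esub> w) \<circ> wreath_perm m n w = id"
    "wreath_perm m n w \<circ> wreath_perm m n (inv\<^bsub>wreath B n\<^esub> w) = id"
    using assms(2) wreath_perm_one by (simp_all flip: wreath_perm_mult)
  then have "bij (wreath_perm m n w)"
    using o_bij by blast
  then show ?thesis
    unfolding permutes_def using wreath_perm_outside by (auto simp: bij_iff)
qed

text \<open>A point determines its block and its place there, so the image of a point gives both
  \<open>(y + i) mod n\<close> and \<open>f y r\<close>. Outside \<open>{1..m}\<close> the
  coordinate permutations are the identity.\<close>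

lemma wreath_perm_inj:
  assumes "n > 0" "m > 0"
  shows "inj_on (wreath_perm m n) (carrier (wreath B n))"
proof (rule inj_onI, safe)
  fix f i g j
  assume "(f, i) \<in> carrier (wreath B n)" "(g, j) \<in> carrier (wreath B n)"
    and eq: "wreath_perm m n (f, i) = wreath_perm m n (g, j)"
  then have fE: "f \<in> {..<n} \<rightarrow>\<^sub>E Q" and gE: "g \<in> {..<n} \<rightarrow>\<^sub>E Q" and ij: "i < n" "j < n"
    by (auto simp: carrier_wreath)
  have f: "f y permutes {1..m}" and g: "g y permutes {1..m}" if "y < n" for y
    using PiE_mem[OF fE] PiE_mem[OF gE] that permutes by blast+
  have *: "(y + i) mod n = (y + j) mod n \<and> f y r = g y r" if y: "y < n" and r: "r \<in> {1..m}" for y r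
  proof -
    have "(y + i) mod n * m + f y r = (y + j) mod n * m + g y r"
      using fun_cong[OF eq, of "y * m + r"] wreath_perm_block[OF y r] by simp
    moreover have "f y r \<in> {1..m}" "g y r \<in> {1..m}"
      using permutes_in_image[OF f[OF y]] permutes_in_image[OF g[OF y]] r by blast+
    ultimately show ?thesis
      using block_div_mod by metis
  qed
  \<comment> \<open>The shifts are compared at the first point of block 0, which exists because
    \<open>n\<close> and \<open>m\<close> are positive.\<close>
  from *[of 0 1] assms ij show "i = j"
    by simp
  show "f = g"
  proof (rule PiE_ext[OF fE gE])
    fix y assume "y \<in> {..<n}"
    then have y: "y < n" by simp
    show "f y = g y"
    proof
      fix r
      show "f y r = g y r"
        using *[OF y] permutes_not_in[OF f[OF y]] permutes_not_in[OF g[OF y]] by (cases "r \<in> {1..m}") auto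
    qed
  qed
qed

lemma wreath_embedding:
  assumes "n > 0" "m > 0"
  obtains R where "subgroup R (sym_group (m * n))" "card R = card Q ^ n * n"
    "wreath_perm m n \<in> iso (wreath B n) (sym_group (m * n)\<lparr>carrier := R\<rparr>)"
proof
  interpret W: group "wreath B n"
    using group.wreath_group[OF group_B assms(1)] .
  interpret S: group "sym_group (m * n)"
    by (rule sym_group_is_group)
  have hom: "wreath_perm m n \<in> hom (wreath B n) (sym_group (m * n))"
    using wreath_perm_permutes[OF assms(1)] wreath_perm_mult
    by (intro homI) (auto simp: sym_group_carrier sym_group_mult)
  then interpret group_hom "wreath B n" "sym_group (m * n)" "wreath_perm m n"
    by unfold_locales
  let ?R = "wreath_perm m n ` carrier (wreath B n)"
  show "subgroup ?R (sym_group (m * n))"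
    by (rule img_is_subgroup)
  show "card ?R = card Q ^ n * n"
    using card_image[OF wreath_perm_inj[OF assms]] by (simp add: card_wreath)
  show "wreath_perm m n \<in> iso (wreath B n) (sym_group (m * n)\<lparr>carrier := ?R\<rparr>)"
    using hom wreath_perm_inj[OF assms] by (auto simp: iso_def hom_def bij_betw_def)
qed

end

section \<open>Legendre's formula at prime powers\<close>

text \<open>Among the \<open>p\<close> factors after \<open>p * m\<close>, only
  \<open>p * Suc m\<close> is divisible by \<open>p\<close>, and it contributes one more than
  \<open>Suc m\<close> does.\<close>

lemma multiplicity_fact_mult:
  fixes p :: nat
  assumes "Factorial_Ring.prime p"
  shows "multiplicity p (fact (p * m)) = m + multiplicity p (fact m :: nat)"
proof (induction m)
  case (Suc m)
  have p: "p > 1" "prime_elem p"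
    using assms prime_gt_1_nat by auto
  have step: "multiplicity p (fact (p * m + j)) = multiplicity p (fact (p * m) :: nat)" if "j < p" for j
    using that
  proof (induction j)
    case (Suc j)
    have "\<not> p dvd p * m + Suc j"
      using Suc.prems by (metis dvd_add_times_triv_left_iff dvd_imp_le mult.commute not_le zero_less_Suc)
    then have "multiplicity p (p * m + Suc j) = 0"
      by (rule not_dvd_imp_multiplicity_0)
    moreover have "multiplicity p (fact (p * m + Suc j)) =
        multiplicity p (p * m + Suc j) + multiplicity p (fact (p * m + j) :: nat)"
      using p(2) by (simp add: prime_elem_multiplicity_mult_distrib del: mult_Suc mult_Suc_right)
    ultimately show ?case
      using Suc by simp
  qed simp
  obtain q where q: "p = Suc q"
    using p(1) by (cases p) auto
  have e: "p * Suc m = Suc (p * m + q)"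
    using q by simp
  have "multiplicity p (fact (p * Suc m)) =
      multiplicity p (p * Suc m) + multiplicity p (fact (p * m + q) :: nat)"
    unfolding e fact_Suc using p(2) by (subst prime_elem_multiplicity_mult_distrib) simp_all
  also have "multiplicity p (p * Suc m) = Suc (multiplicity p (Suc m))"
    using p by (intro multiplicity_times_same) auto
  also have "multiplicity p (fact (p * m + q) :: nat) = m + multiplicity p (fact m :: nat)"
    using step[of q] q Suc.IH by simp
  also have "Suc (multiplicity p (Suc m)) + (m + multiplicity p (fact m :: nat)) =
      Suc m + multiplicity p (fact (Suc m) :: nat)"
    unfolding fact_Suc using p(2) by (subst prime_elem_multiplicity_mult_distrib) simp_all
  finally show ?case .
qed simp

text \<open>This matches the order \<open>card Q ^ p * p\<close> of a wreath product: passing to the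
  next level multiplies the exponent of \<open>p\<close> by \<open>p\<close> and adds 1.\<close>

lemma multiplicity_fact_prime_power:
  fixes p :: nat
  assumes "Factorial_Ring.prime p"
  shows "multiplicity p (fact (p ^ Suc k)) = p * multiplicity p (fact (p ^ k) :: nat) + 1"
proof (induction k)
  case 0
  show ?case
    using multiplicity_fact_mult[OF assms, of 1] by simp
next
  case (Suc k)
  have "multiplicity p (fact (p ^ Suc (Suc k))) = p * p ^ k + multiplicity p (fact (p ^ Suc k) :: nat)"
    using multiplicity_fact_mult[OF assms, of "p ^ Suc k"] by simp
  also have "\<dots> = p * (p ^ k + multiplicity p (fact (p ^ k) :: nat)) + 1"
    by (simp only: Suc distrib_left add.assoc)
  also have "p ^ k + multiplicity p (fact (p ^ k) :: nat) = multiplicity p (fact (p ^ Suc k) :: nat)"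
    using multiplicity_fact_mult[OF assms, of "p ^ k"] by simp
  finally show ?case .
qed

lemma order_sym_group: "order (sym_group n) = fact n"
  by (simp add: order_def sym_group_card_carrier)

lemma finite_sym_group: "finite (carrier (sym_group n))"
  by (simp add: sym_group_def finite_permutations)

section \<open>Sylow subgroups of symmetric and alternating groups\<close>

text \<open>Induction starts at the trivial group on one point; each step takes the wreath product
  with the cyclic group of order \<open>p\<close>. Noncommutativity appears from the second step on,
  once the base group is nontrivial.\<close>

lemma sylow_sym_group_exists:
  fixes p :: nat
  assumes p: "Factorial_Ring.prime p"
  shows "\<exists>Q. sylow_subgroup p Q (sym_group (p ^ k)) \<and>
    derived_commutators (sym_group (p ^ k)\<lparr>carrier := Q\<rparr>) \<and>
    (k > 1 \<longrightarrow> \<not> comm_group (sym_group (p ^ k)\<lparr>carrier := Q\<rparr>))"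
proof (induction k)
  case 0
  interpret S: group "sym_group 1"
    by (rule sym_group_is_group)
  have sub: "subgroup {\<one>\<^bsub>sym_group 1\<^esub>} (sym_group 1)"
    by (rule S.triv_subgroup)
  let ?T = "sym_group 1\<lparr>carrier := {\<one>\<^bsub>sym_group 1\<^esub>}\<rparr>"
  interpret T: group ?T
    using S.subgroup_imp_group[OF sub] .
  have "comm_group ?T"
    by (rule T.group_comm_groupI) auto
  then have "derived_commutators ?T"
    by (rule comm_group.derived_commutators)
  moreover have "sylow_subgroup p {\<one>\<^bsub>sym_group 1\<^esub>} (sym_group 1)"
    using sub by (simp add: sylow_subgroup_def order_sym_group)
  ultimately show ?case
    by auto
next
  case (Suc k)
  then obtain Q where Q: "sylow_subgroup p Q (sym_group (p ^ k))"
    "derived_commutators (sym_group (p ^ k)\<lparr>carrier := Q\<rparr>)" by blast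
  have p1: "p > 1"
    using p prime_gt_1_nat by blast
  interpret perm_subgroup "p ^ k" Q
    using Q(1) by (simp add: perm_subgroup_def sylow_subgroup_def)
  interpret B: group B
    by (rule group_B)
  have cardQ: "card Q = p ^ multiplicity p (fact (p ^ k) :: nat)"
    using Q(1) by (simp add: sylow_subgroup_def order_sym_group)
  obtain R where R: "subgroup R (sym_group (p ^ k * p))" "card R = card Q ^ p * p"
    "wreath_perm (p ^ k) p \<in> iso (wreath B p) (sym_group (p ^ k * p)\<lparr>carrier := R\<rparr>)"
    using wreath_embedding[of p] p1 by auto
  let ?R = "sym_group (p ^ k * p)\<lparr>carrier := R\<rparr>"
  have W: "group (wreath B p)"
    using p1 by (intro B.wreath_group) simp
  have R': "group ?R"
    using R(1) sym_group_is_group group.subgroup_imp_group by blast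
  have "card Q ^ p * p = p ^ multiplicity p (fact (p ^ Suc k) :: nat)"
    unfolding multiplicity_fact_prime_power[OF p] cardQ by (simp add: mult.commute flip: power_mult)
  then have "sylow_subgroup p R (sym_group (p ^ Suc k))"
    using R(1,2) by (simp add: sylow_subgroup_def order_sym_group mult.commute)
  moreover have "derived_commutators ?R"
    using derived_commutators_iso[OF W R' R(3)] B.derived_commutators_wreath[OF p1 Q(2)] by blast
  moreover have "\<not> comm_group ?R" if k: "Suc k > 1"
  proof -
    \<comment> \<open>With \<open>k = Suc l\<close> the exponent of \<open>p\<close> in
      \<open>card Q\<close> has the form \<open>p * e + 1\<close>, so it is positive.\<close>
    obtain l where "k = Suc l"
      using k by (cases k) auto
    then have "card Q > 1"
      unfolding cardQ using p1 by (simp only: multiplicity_fact_prime_power[OF p] one_less_power)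
    then obtain g where "g \<in> Q" "g \<noteq> \<one>\<^bsub>B\<^esub>"
      using card_mono[of "{\<one>\<^bsub>B\<^esub>}" Q] by fastforce
    then have "\<not> comm_group (wreath B p)"
      using B.wreath_not_comm[OF p1] by simp
    then show ?thesis
      using comm_group_iso_iff[OF W R'] R(3) is_isoI by blast
  qed
  ultimately show ?case
    by (metis power_Suc2)
qed

lemma commutator_width_sylow_sym_group:
  fixes p :: nat
  assumes p: "Factorial_Ring.prime p" and k: "k > 1" and P: "sylow_subgroup p P (sym_group (p ^ k))"
  shows "commutator_width (sym_group (p ^ k)\<lparr>carrier := P\<rparr>) = 1"
proof -
  let ?S = "sym_group (p ^ k)"
  interpret S: group ?S
    by (rule sym_group_is_group)
  obtain Q where Q: "sylow_subgroup p Q ?S" "derived_commutators (?S\<lparr>carrier := Q\<rparr>)"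
    "\<not> comm_group (?S\<lparr>carrier := Q\<rparr>)"
    using sylow_sym_group_exists[OF p, of k] k by blast
  have grp: "group (?S\<lparr>carrier := P\<rparr>)" "group (?S\<lparr>carrier := Q\<rparr>)"
    using P Q(1) S.subgroup_imp_group by (auto simp: sylow_subgroup_def)
  have "?S\<lparr>carrier := Q\<rparr> \<cong> ?S\<lparr>carrier := P\<rparr>"
    using S.sylow_subgroups_iso[OF finite_sym_group p Q(1) P] .
  moreover from this obtain h where "h \<in> iso (?S\<lparr>carrier := Q\<rparr>) (?S\<lparr>carrier := P\<rparr>)"
    by (auto simp: is_iso_def)
  moreover have "finite P"
    using P finite_sym_group finite_subset subgroup.subset unfolding sylow_subgroup_def by blast
  ultimately show ?thesis
    using group.commutator_width_eq_1[OF grp(1)] derived_commutators_iso[OF grp(2,1)]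
      comm_group_iso_iff[OF grp(2,1)] Q(2,3) by simp
qed

text \<open>For \<open>n \<ge> 2\<close> the alternating group has index 2, which is prime to an odd
  \<open>p\<close>, so both group orders contain the same power of \<open>p\<close>.\<close>

lemma sylow_alt_group_imp_sylow_sym_group:
  fixes p :: nat
  assumes p: "Factorial_Ring.prime p" "p > 2" and n: "n \<ge> 2" and P: "sylow_subgroup p P (alt_group n)"
  shows "sylow_subgroup p P (sym_group n)"
proof -
  have "\<not> p dvd 2"
    using p(2) dvd_imp_le by fastforce
  then have "multiplicity p (2 :: nat) = 0"
    by (rule not_dvd_imp_multiplicity_0)
  moreover have "order (alt_group n) \<noteq> 0"
    using alt_group_card_carrier[OF n] by (metis fact_nonzero mult_0_right order_def)
  ultimately have "multiplicity p (2 * order (alt_group n)) = multiplicity p (order (alt_group n))"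
    using p(1) by (simp add: prime_elem_multiplicity_mult_distrib)
  then have "multiplicity p (order (sym_group n)) = multiplicity p (order (alt_group n))"
    using alt_group_card_carrier[OF n] by (simp add: order_def sym_group_card_carrier)
  moreover have "subgroup P (sym_group n)"
    using P group.incl_subgroup[OF sym_group_is_group alt_group_is_subgroup]
    unfolding sylow_subgroup_def alt_group_def by fastforce
  ultimately show ?thesis
    using P by (simp add: sylow_subgroup_def)
qed

theorem corollary7:
  fixes k :: nat
  assumes "k > 1"
  shows "(\<forall>(p::nat) P. Factorial_Ring.prime p \<longrightarrow> sylow_subgroup p P (sym_group (p ^ k)) \<longrightarrow>
            commutator_width (sym_group (p ^ k) \<lparr> carrier := P \<rparr>) = 1)
       \<and> (\<forall>(p::nat) P. Factorial_Ring.prime p \<longrightarrow> p > 2 \<longrightarrow> sylow_subgroup p P (alt_group (p ^ k)) \<longrightarrow>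
            commutator_width (alt_group (p ^ k) \<lparr> carrier := P \<rparr>) = 1)"
proof (intro conjI allI impI)
  fix p :: nat and P
  assume p: "Factorial_Ring.prime p"
  {
    assume "sylow_subgroup p P (sym_group (p ^ k))"
    then show "commutator_width (sym_group (p ^ k)\<lparr>carrier := P\<rparr>) = 1"
      by (rule commutator_width_sylow_sym_group[OF p assms])
  }
  {
    assume p2: "p > 2" and P: "sylow_subgroup p P (alt_group (p ^ k))"
    have "2 \<le> p ^ k"
      using p2 assms self_le_power[of p k] by linarith
    with P have "sylow_subgroup p P (sym_group (p ^ k))"
      by (intro sylow_alt_group_imp_sylow_sym_group p p2)
    then have "commutator_width (sym_group (p ^ k)\<lparr>carrier := P\<rparr>) = 1"
      by (rule commutator_width_sylow_sym_group[OF p assms])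
    then show "commutator_width (alt_group (p ^ k)\<lparr>carrier := P\<rparr>) = 1"
      \<comment> \<open>\<open>alt_group\<close> is \<open>sym_group\<close> with a smaller carrier,
        so replacing the carrier by \<open>P\<close> gives the same structure from either.\<close>
      by (simp add: alt_group_def)
  }
qed

end
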